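(* Let $n\ge3$, $2^{n-3}<k\le 2^{n-2}$, and let $H$ be a spanned hyperplane of $Q_n$ containing at least $k$ points of $V_n$. Let $H\cap w_1(H),\dots,H\cap w_{h_2}(H)$ be representatives of the equivalence classes of $E(H,k)$ under $B_n$. Define $\Phi_2$ on the disjoint union $\bigsqcup_{i=1}^{h_2}\mathcal{P}(H\cap w_i(H),k)$ by sending a partial $0/1$-equivalence class of $H\cap w_i(H)$ to the unique partial $0/1$-equivalence class of $H$ containing it. Then $\Phi_2$ takes values in $\mathcal{P}_*(H,k)$ and is a bijection onto $\mathcal{P}_*(H,k)$.
   Context: $Q_n=[0,1]^n$, $V_n=\{0,1\}^n$. A $0/1$-polytope of $Q_n$ is the convex hull of a nonempty subset of $V_n$; it has $k$ vertices if the subset has $k$ elements. $B_n$ is the group of signed permutations $w$ of $\{1,\dots,n\}$ (underlying permutation $\pi$, sign $\pm$ on each $i$) acting on $\mathbb{R}^n$ by $w(x)_i=x_{\pi(i)}$ (sign $+$) or $1-x_{\pi(i)}$ (sign $-$), and on subsets by taking images. A spanned hyperplane of $Q_n$ is a hyperplane $H$ such that the affine hull of $H\cap V_n$ is $H$; $F(H)=\{w\in B_n:w(H)=H\}$. $E(H,k)$ is the set of intersections $H\cap w(H)$ with $w\in B_n$, $w(H)\ne H$, containing at least $k$ points of $V_n$; two of them are equivalent under a group $G\subseteq B_n$ if some $g\in G$ maps one onto the other. For $\mathcal S\subset\mathbb{R}^n$: partial $0/1$-equivalence classes of $\mathcal S$ are the classes of $0/1$-polytopes contained in $\mathcal S$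 under $P\sim P'$ iff $g(P)=P'$ for some $g\in B_n$, and $\mathcal{P}(\mathcal S,k)$ is the set of those with $k$ vertices; for $\mathcal S\subset H$, local $0/1$-equivalence classes of $\mathcal S$ are defined the same way but with $g\in F(H)$, and $\mathcal{L}(\mathcal S,k)$ is the set of those with $k$ vertices. Let $H\cap v_1(H),\dots,H\cap v_{h_1}(H)$ be representatives of the classes of $E(H,k)$ under $F(H)$; let $\mathcal{L}_*(H,k)\subseteq\mathcal{L}(H,k)$ be the set of local classes of $H$ containing some local class in $\mathcal{L}(H\cap v_i(H),k)$ for some $i$, and $\mathcal{L}^*(H,k)=\mathcal{L}(H,k)\setminus\mathcal{L}_*(H,k)$. Finally $\mathcal{P}_*(H,k)$ is the set of classes in $\mathcal{P}(H,k)$ that are not equal (as sets of polytopes) to any class in $\mathcal{L}^*(H,k)$. *)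

theory Defs
  imports "HOL-Analysis.Analysis"
begin

definition cube_vertices :: "(real ^ 'n) set" where
  "cube_vertices = {x. \<forall>i. x $ i = 0 \<or> x $ i = 1}"

text \<open>The coordinates \<open>1, \<dots>, n\<close> are the elements of the index type \<open>'n\<close>. A signed permutation is a
  pair \<open>(\<pi>, s)\<close>, where \<open>s i\<close> means that \<open>i\<close> carries the sign \<open>-\<close>.\<close>

type_synonym 'n signed_perm = "('n \<Rightarrow> 'n) \<times> ('n \<Rightarrow> bool)"

definition signed_perms :: "'n signed_perm set" where
  "signed_perms = {w. bij (fst w)}"

definition act :: "'n signed_perm \<Rightarrow> real ^ 'n \<Rightarrow> real ^ 'n" where
  "act w x = (\<chi> i. if snd w i then 1 - x $ fst w i else x $ fst w i)"

definition equivalent_under ::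
    "'n signed_perm set \<Rightarrow> (real ^ 'n) set \<Rightarrow> (real ^ 'n) set \<Rightarrow> bool" where
  "equivalent_under G A B \<longleftrightarrow> (\<exists>g\<in>G. act g ` A = B)"

definition zero_one_polytope :: "(real ^ 'n) set \<Rightarrow> bool" where
  "zero_one_polytope P \<longleftrightarrow>
    (\<exists>W. W \<subseteq> cube_vertices \<and> W \<noteq> {} \<and> P = convex hull W)"

definition has_num_vertices :: "(real ^ 'n) set \<Rightarrow> nat \<Rightarrow> bool" where
  "has_num_vertices P k \<longleftrightarrow>
    (\<exists>W. W \<subseteq> cube_vertices \<and> W \<noteq> {} \<and> P = convex hull W \<and> card W = k)"

definition spanned_hyperplane :: "(real ^ 'n) set \<Rightarrow> bool" where
  "spanned_hyperplane H \<longleftrightarrow>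
    (\<exists>a b. a \<noteq> 0 \<and> H = {x. a \<bullet> x = b}) \<and> affine hull (H \<inter> cube_vertices) = H"

definition stabilizer :: "(real ^ 'n) set \<Rightarrow> 'n signed_perm set" where
  "stabilizer H = {w \<in> signed_perms. act w ` H = H}"

definition E :: "(real ^ 'n) set \<Rightarrow> nat \<Rightarrow> (real ^ 'n) set set" where
  "E H k = {H \<inter> act w ` H | w. w \<in> signed_perms \<and> act w ` H \<noteq> H \<and>
    k \<le> card (H \<inter> act w ` H \<inter> cube_vertices)}"

definition polytopes_in :: "(real ^ 'n) set \<Rightarrow> (real ^ 'n) set set" where
  "polytopes_in S = {P. zero_one_polytope P \<and> P \<subseteq> S}"

definition classes :: "'n signed_perm set \<Rightarrow> (real ^ 'n) set \<Rightarrow> (real ^ 'n) set set set" where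
  "classes G S = polytopes_in S //
    {(P, Q). P \<in> polytopes_in S \<and> Q \<in> polytopes_in S \<and> equivalent_under G P Q}"

definition partial_classes :: "(real ^ 'n) set \<Rightarrow> (real ^ 'n) set set set" where
  "partial_classes S = classes signed_perms S"

definition partial_classes_k :: "(real ^ 'n) set \<Rightarrow> nat \<Rightarrow> (real ^ 'n) set set set" where
  "partial_classes_k S k = {C \<in> partial_classes S. \<forall>P\<in>C. has_num_vertices P k}"

text \<open>Local classes of \<open>S \<subseteq> H\<close> depend on \<open>H\<close> through its stabilizer, so \<open>H\<close> is an explicit
  argument.\<close>

definition local_classes :: "(real ^ 'n) set \<Rightarrow> (real ^ 'n) set \<Rightarrow> (real ^ 'n) set set set" where
  "local_classes H S = classes (stabilizer H) S"

definition local_classes_k ::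
    "(real ^ 'n) set \<Rightarrow> (real ^ 'n) set \<Rightarrow> nat \<Rightarrow> (real ^ 'n) set set set" where
  "local_classes_k H S k = {C \<in> local_classes H S. \<forall>P\<in>C. has_num_vertices P k}"

text \<open>\<open>H \<inter> v\<^sub>1(H), \<dots>, H \<inter> v\<^sub>h(H)\<close> represent the classes of \<open>E H k\<close> under \<open>G\<close>, each class exactly
  once.\<close>

definition class_reps ::
    "'n signed_perm set \<Rightarrow> (real ^ 'n) set \<Rightarrow> nat \<Rightarrow> nat \<Rightarrow> (nat \<Rightarrow> 'n signed_perm) \<Rightarrow> bool" where
  "class_reps G H k h v \<longleftrightarrow>
    (\<forall>i\<in>{1..h}. v i \<in> signed_perms \<and> H \<inter> act (v i) ` H \<in> E H k) \<and>
    (\<forall>S\<in>E H k. \<exists>!i. i \<in> {1..h} \<and> equivalent_under G S (H \<inter> act (v i) ` H))"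

text \<open>\<open>\<L>\<^sub>*\<close>, \<open>\<L>\<^sup>*\<close> and \<open>\<P>\<^sub>*\<close>, formed with the representatives \<open>H \<inter> v\<^sub>1(H), \<dots>, H \<inter> v\<^sub>h(H)\<close> of the classes
  of \<open>E H k\<close> under the stabilizer of \<open>H\<close>.\<close>

definition L_lower ::
    "(real ^ 'n) set \<Rightarrow> nat \<Rightarrow> nat \<Rightarrow> (nat \<Rightarrow> 'n signed_perm) \<Rightarrow> (real ^ 'n) set set set" where
  "L_lower H k h v = {C \<in> local_classes_k H H k.
    \<exists>i\<in>{1..h}. \<exists>D\<in>local_classes_k H (H \<inter> act (v i) ` H) k. D \<subseteq> C}"

definition L_upper ::
    "(real ^ 'n) set \<Rightarrow> nat \<Rightarrow> nat \<Rightarrow> (nat \<Rightarrow> 'n signed_perm) \<Rightarrow> (real ^ 'n) set set set" where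
  "L_upper H k h v = local_classes_k H H k - L_lower H k h v"

definition P_lower ::
    "(real ^ 'n) set \<Rightarrow> nat \<Rightarrow> nat \<Rightarrow> (nat \<Rightarrow> 'n signed_perm) \<Rightarrow> (real ^ 'n) set set set" where
  "P_lower H k h v = partial_classes_k H k - L_upper H k h v"

text \<open>The disjoint union is formed as a dependent sum over the index \<open>i\<close>.\<close>

definition Phi2_domain ::
    "(real ^ 'n) set \<Rightarrow> nat \<Rightarrow> nat \<Rightarrow> (nat \<Rightarrow> 'n signed_perm) \<Rightarrow> (nat \<times> (real ^ 'n) set set) set" where
  "Phi2_domain H k h w = (SIGMA i:{1..h}. partial_classes_k (H \<inter> act (w i) ` H) k)"

definition Phi2 :: "(real ^ 'n) set \<Rightarrow> nat \<times> (real ^ 'n) set set \<Rightarrow> (real ^ 'n) set set" where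
  "Phi2 H = (\<lambda>(i, C). THE D. D \<in> partial_classes H \<and> C \<subseteq> D)"

end

theory Submission
  imports Defs
begin

text \<open>An affine subspace of dimension \<open>d\<close> contains at most \<open>2 ^ d\<close> vertices of the cube. Hence a
  \<open>0/1\<close>-polytope with \<open>k > 2 ^ (n - 3)\<close> vertices inside \<open>H \<inter> g(H)\<close>, where \<open>g(H) \<noteq> H\<close>, affinely
  spans this intersection. An equivalence between two such polytopes therefore carries one
  intersection onto the other, which gives injectivity. For surjectivity, a partial class of \<open>H\<close>
  which is not a local class contains two polytopes related by some \<open>g\<close> outside the stabilizer
  of \<open>H\<close>, and so a polytope inside some \<open>H \<inter> g(H)\<close>; a local class in \<open>\<L>\<^sub>*\<close> contains such a polytope
  by definition.\<close>

section \<open>Signed permutations\<close>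

lemma act_comp:
  assumes "g \<in> signed_perms" "h \<in> signed_perms"
  shows "\<exists>f\<in>signed_perms. act f = act g \<circ> act h"
proof
  \<comment> \<open>The action reads coordinate \<open>i\<close> of its result at
    \<open>fst g i\<close>, so permutations compose in reverse order. Two reflections of one
    coordinate cancel, so the signs combine by exclusive or, with that of \<open>h\<close> taken at
    \<open>fst g i\<close>.\<close>
  let ?f = "(fst h \<circ> fst g, \<lambda>i. snd g i \<noteq> snd h (fst g i))"
  show "?f \<in> signed_perms"
    using assms by (auto simp: signed_perms_def intro: bij_comp)
  show "act ?f = act g \<circ> act h"
    by (auto simp: act_def fun_eq_iff vec_eq_iff)
qed

lemma act_inverse:
  assumes "g \<in> signed_perms"
  shows "\<exists>h\<in>signed_perms. act h \<circ> act g = id"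
proof
  \<comment> \<open>Undoing \<open>act g\<close> reads coordinate \<open>i\<close> from position
    \<open>inv (fst g) i\<close>; the reflection made there is its own inverse, so its sign is
    kept.\<close>
  let ?h = "(inv (fst g), \<lambda>i. snd g (inv (fst g) i))"
  have b: "bij (fst g)" using assms by (simp add: signed_perms_def)
  show "?h \<in> signed_perms"
    using b by (simp add: signed_perms_def bij_imp_bij_inv)
  show "act ?h \<circ> act g = id"
    using b by (auto simp: act_def fun_eq_iff vec_eq_iff bij_is_surj surj_f_inv_f)
qed

lemma act_id: "\<exists>f\<in>signed_perms. act f = id"
  by (rule bexI[of _ "(id, \<lambda>_. False)"]) (auto simp: act_def signed_perms_def fun_eq_iff)

text \<open>Coordinatewise, 1 - t is -t translated by 1: \<open>L\<close> is a signed permutation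
  matrix and \<open>c\<close> the indicator of the negative signs. Hulls and dimensions are then
  transported through the linear map and the translation separately.\<close>

lemma act_affine:
  assumes "g \<in> signed_perms"
  obtains L c where "linear L" "inj L" "act g = (+) c \<circ> L"
proof
  let ?L = "\<lambda>x::real^'a. \<chi> i. if snd g i then - x $ fst g i else x $ fst g i"
  show "linear ?L"
    by (rule linearI) (auto simp: vec_eq_iff)
  show "inj ?L"
  proof (rule injI)
    fix x y assume eq: "?L x = ?L y"
    have "x $ fst g i = y $ fst g i" for i
      using arg_cong[OF eq, of "\<lambda>z. z $ i"] by (auto split: if_splits)
    moreover have "surj (fst g)" using assms by (simp add: signed_perms_def bij_is_surj)
    ultimately show "x = y" by (metis vec_eq_iff surjD)
  qed
  show "act g = (+) (\<chi> i. if snd g i then 1 else 0) \<circ> ?L"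
    by (auto simp: act_def fun_eq_iff vec_eq_iff)
qed

lemma inj_act: "g \<in> signed_perms \<Longrightarrow> inj (act g)"
  using act_inverse by (metis inj_on_id inj_on_imageI2)

lemma affine_hull_act:
  assumes "g \<in> signed_perms"
  shows "affine hull (act g ` X) = act g ` (affine hull X)"
proof -
  obtain L c where "linear L" "act g = (+) c \<circ> L" using act_affine[OF assms] .
  then show ?thesis
    by (simp only: image_comp[symmetric] affine_hull_translation affine_hull_linear_image
        linear_linear)
qed

lemma convex_hull_act:
  assumes "g \<in> signed_perms"
  shows "convex hull (act g ` X) = act g ` (convex hull X)"
proof -
  obtain L c where "linear L" "act g = (+) c \<circ> L" using act_affine[OF assms] .
  then show ?thesis
    by (simp only: image_comp[symmetric] convex_hull_translation convex_hull_linear_image)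
qed

lemma aff_dim_act:
  assumes "g \<in> signed_perms"
  shows "aff_dim (act g ` X) = aff_dim X"
proof -
  obtain L c where "linear L" "inj L" "act g = (+) c \<circ> L" using act_affine[OF assms] .
  then show ?thesis
    by (simp only: image_comp[symmetric] aff_dim_translation_eq aff_dim_injective_linear_image)
qed

lemma act_cube_vertices: "W \<subseteq> cube_vertices \<Longrightarrow> act g ` W \<subseteq> cube_vertices"
  by (fastforce simp: act_def cube_vertices_def)

lemma zero_one_polytope_act:
  assumes "g \<in> signed_perms" "zero_one_polytope P"
  shows "zero_one_polytope (act g ` P)"
  using assms unfolding zero_one_polytope_def
  by (metis act_cube_vertices convex_hull_act image_is_empty)

lemma has_num_vertices_act:
  assumes g: "g \<in> signed_perms" and P: "has_num_vertices P k"
  shows "has_num_vertices (act g ` P) k"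
proof -
  obtain W where W: "W \<subseteq> cube_vertices" "W \<noteq> {}" "P = convex hull W" "card W = k"
    using P unfolding has_num_vertices_def by blast
  have "card (act g ` W) = k"
    using W(4) card_image[OF inj_on_subset[OF inj_act[OF g]], of W] by simp
  with W show ?thesis
    unfolding has_num_vertices_def
    by (intro exI[of _ "act g ` W"]) (simp add: act_cube_vertices convex_hull_act[OF g])
qed

lemma polytopes_in_act:
  assumes "g \<in> signed_perms" "P \<in> polytopes_in S" "act g ` S = T"
  shows "act g ` P \<in> polytopes_in T"
  using assms zero_one_polytope_act unfolding polytopes_in_def by blast

section \<open>Equivalence classes\<close>

lemma equivalent_refl: "equivalent_under signed_perms A A"
  unfolding equivalent_under_def using act_id by (metis image_id id_apply)

lemma equivalent_sym:
  "equivalent_under signed_perms A B \<Longrightarrow> equivalent_under signed_perms B A"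
  unfolding equivalent_under_def using act_inverse by (metis image_comp image_id id_apply)

lemma equivalent_trans:
  "equivalent_under signed_perms A B \<Longrightarrow> equivalent_under signed_perms B C \<Longrightarrow>
    equivalent_under signed_perms A C"
  unfolding equivalent_under_def using act_comp by (metis image_comp)

lemma equivalent_stabilizer:
  "equivalent_under (stabilizer H) A B \<Longrightarrow> equivalent_under signed_perms A B"
  unfolding equivalent_under_def stabilizer_def by blast

lemma equivalent_stabilizer_refl: "equivalent_under (stabilizer H) A A"
  unfolding equivalent_under_def stabilizer_def using act_id
  by (metis (mono_tags, lifting) image_id id_apply mem_Collect_eq)

lemma classes_iff:
  "C \<in> classes G S \<longleftrightarrow>
    (\<exists>P\<in>polytopes_in S. C = {Q \<in> polytopes_in S. equivalent_under G P Q})"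
  unfolding classes_def quotient_def by auto

text \<open>Symmetry and transitivity let any member serve as representative, so later arguments may
  describe a class by whichever polytope is at hand.\<close>

lemma partial_class_eq:
  assumes "C \<in> partial_classes S" "P \<in> C"
  shows "C = {Q \<in> polytopes_in S. equivalent_under signed_perms P Q}"
proof -
  obtain R where R: "C = {Q \<in> polytopes_in S. equivalent_under signed_perms R Q}"
    using assms(1) unfolding partial_classes_def classes_iff by blast
  then have "equivalent_under signed_perms R P" using assms(2) by blast
  then have "equivalent_under signed_perms R Q \<longleftrightarrow> equivalent_under signed_perms P Q" for Q
    using equivalent_sym equivalent_trans by blast
  then show ?thesis unfolding R by blast
qed

lemma partial_classI:
  "P \<in> polytopes_in S \<Longrightarrow>
    {Q \<in> polytopes_in S. equivalent_under signed_perms P Q} \<in> partial_classes S"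
  unfolding partial_classes_def classes_iff by blast

lemma partial_class_nonempty:
  assumes "C \<in> partial_classes S"
  obtains P where "P \<in> C" "P \<in> polytopes_in S"
  using assms equivalent_refl unfolding partial_classes_def classes_iff by blast

text \<open>One polytope \<open>P\<close> of \<open>C\<close> decides everything: its class in
  \<open>T\<close> contains \<open>C\<close>, and any class of \<open>T\<close> containing
  \<open>C\<close> contains \<open>P\<close> and is therefore that one. This makes the description
  in \<open>Phi2\<close> well defined.\<close>

lemma partial_class_unique_extension:
  assumes "C \<in> partial_classes S" "S \<subseteq> T"
  shows "\<exists>!D. D \<in> partial_classes T \<and> C \<subseteq> D"
proof -
  obtain P where P: "P \<in> C" "P \<in> polytopes_in S" using partial_class_nonempty[OF assms(1)] .
  have mono: "polytopes_in S \<subseteq> polytopes_in T" using assms(2) unfolding polytopes_in_def by blast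
  show ?thesis
  proof
    show "{Q \<in> polytopes_in T. equivalent_under signed_perms P Q} \<in> partial_classes T \<and>
        C \<subseteq> {Q \<in> polytopes_in T. equivalent_under signed_perms P Q}"
      using P mono partial_classI[of P T] partial_class_eq[OF assms(1) P(1)] by blast
  qed (use P(1) partial_class_eq in blast)
qed

section \<open>Vertices of the cube in affine subspaces\<close>

lemma finite_cube_vertices: "finite (cube_vertices :: (real ^ 'n) set)"
proof (rule finite_subset)
  show "cube_vertices \<subseteq> range (\<lambda>f. \<chi> i::'n. if f i then 1 else (0::real))"
  proof
    fix x :: "real ^ 'n" assume "x \<in> cube_vertices"
    then have "x = (\<chi> i. if x $ i = 1 then 1 else 0)"
      by (auto simp: cube_vertices_def vec_eq_iff)
    then show "x \<in> range (\<lambda>f. \<chi> i::'n. if f i then 1 else (0::real))"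
      by (rule range_eqI[where x = "\<lambda>i. x $ i = 1"])
  qed
qed (rule finite_imageI, simp)

text \<open>The slice lies in the hyperplane y_i = c, which is affine and misses \<open>x\<close>;
  hence its affine hull misses \<open>x\<close> too and is strictly smaller than that of
  \<open>W\<close>.\<close>

lemma aff_dim_facet_less:
  fixes W :: "(real ^ 'n) set"
  assumes "x \<in> W" "x $ i \<noteq> c"
  shows "aff_dim {y \<in> W. y $ i = c} < aff_dim W"
proof (rule aff_dim_psubset)
  have "affine {y :: real ^ 'n. y $ i = c}"
    using affine_hyperplane[of "axis i 1 :: real ^ 'n" c] by (simp add: inner_axis')
  then have "affine hull {y \<in> W. y $ i = c} \<subseteq> {y. y $ i = c}"
    by (intro hull_minimal) auto
  then have "x \<notin> affine hull {y \<in> W. y $ i = c}" using assms(2) by blast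
  moreover have "x \<in> affine hull W" using assms(1) by (rule hull_inc)
  moreover have "affine hull {y \<in> W. y $ i = c} \<subseteq> affine hull W" by (rule hull_mono) auto
  ultimately show "affine hull {y \<in> W. y $ i = c} \<subset> affine hull W" by blast
qed

text \<open>A coordinate that is not constant on \<open>W\<close> splits \<open>W\<close> into two parts of smaller dimension.\<close>

lemma card_cube_vertices_le:
  fixes W :: "(real ^ 'n) set"
  assumes "W \<subseteq> cube_vertices" "aff_dim W \<le> int d"
  shows "card W \<le> 2 ^ d"
  using assms
proof (induction d arbitrary: W)
  case 0
  have "x = y" if "x \<in> W" "y \<in> W" for x y
  proof (rule ccontr)
    assume "x \<noteq> y"
    then obtain i where "x $ i \<noteq> y $ i" by (auto simp: vec_eq_iff)
    \<comment> \<open>The slice through \<open>y\<close> would have dimension below 0, although it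
      is nonempty.\<close>
    then have "aff_dim {z \<in> W. z $ i = y $ i} < aff_dim W"
      using aff_dim_facet_less that(1) by blast
    moreover have "{z \<in> W. z $ i = y $ i} \<noteq> {}" using that(2) by blast
    ultimately show False
      using "0.prems"(2) aff_dim_negative_iff[of "{z \<in> W. z $ i = y $ i}"] by linarith
  qed
  then show ?case
    using card_le_Suc0_iff_eq[OF finite_subset[OF "0.prems"(1) finite_cube_vertices]] by simp
next
  case (Suc d)
  show ?case
  proof (cases "\<forall>x\<in>W. \<forall>y\<in>W. x = y")
    case True
    then have "card W \<le> 1"
      using card_le_Suc0_iff_eq[OF finite_subset[OF Suc.prems(1) finite_cube_vertices]] by simp
    then show ?thesis by (metis order_trans one_le_power one_le_numeral)
  next
    case False
    then obtain x y i where xy: "x \<in> W" "y \<in> W" "x $ i \<noteq> y $ i" by (auto simp: vec_eq_iff)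
    \<comment> \<open>For every \<open>c\<close>, at least one of \<open>x\<close> and
      \<open>y\<close> lies off the slice, so each slice loses a dimension.\<close>
    have part: "card {z \<in> W. z $ i = c} \<le> 2 ^ d" for c
    proof (rule Suc.IH)
      have "aff_dim {z \<in> W. z $ i = c} < aff_dim W"
        using aff_dim_facet_less[OF xy(1), of i c] aff_dim_facet_less[OF xy(2), of i c] xy(3)
        by (cases "x $ i = c") auto
      then show "aff_dim {z \<in> W. z $ i = c} \<le> int d" using Suc.prems(2) by simp
    qed (use Suc.prems(1) in blast)
    have "W = {z \<in> W. z $ i = 0} \<union> {z \<in> W. z $ i = 1}"
      using Suc.prems(1) by (auto simp: cube_vertices_def)
    then have "card W = card ({z \<in> W. z $ i = 0} \<union> {z \<in> W. z $ i = 1})"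
      by (rule arg_cong)
    also have "\<dots> \<le> card {z \<in> W. z $ i = 0} + card {z \<in> W. z $ i = 1}"
      by (rule card_Un_le)
    also have "\<dots> \<le> 2 ^ d + 2 ^ d" using part by (intro add_mono)
    finally show ?thesis by simp
  qed
qed

text \<open>Nonempty affine sets of equal dimension are equal once one contains the other. So
  \<open>H\<close> is not contained in its different image, and the intersection has smaller
  dimension than \<open>H\<close>.\<close>

lemma aff_dim_hyperplane_Int_act:
  fixes H :: "(real ^ 'n) set"
  assumes "a \<noteq> 0" "H = {x. a \<bullet> x = b}" "g \<in> signed_perms" "act g ` H \<noteq> H"
  shows "aff_dim (H \<inter> act g ` H) \<le> int CARD('n) - 2"
proof -
  have aH: "affine H" using assms(2) by (simp add: affine_hyperplane)
  have agH: "affine (act g ` H)"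
    using affine_hull_act[OF assms(3), of H] aH by (metis affine_affine_hull affine_hull_eq)
  have dim: "aff_dim H = int CARD('n) - 1" using assms by (simp add: aff_dim_hyperplane)
  have ne: "H \<noteq> {}" using dim by (auto simp: aff_dim_empty)
  have "\<not> H \<subseteq> act g ` H"
    using affine_dim_equal[OF aH agH ne] aff_dim_act[OF assms(3)] assms(4) by metis
  then have "H \<inter> act g ` H \<subset> H" by blast
  then have "affine hull (H \<inter> act g ` H) \<subset> affine hull H"
    using aH agH by (simp add: affine_Int affine_hull_eq[THEN iffD2])
  then have "aff_dim (H \<inter> act g ` H) < aff_dim H" by (rule aff_dim_psubset)
  then show ?thesis using dim by simp
qed

text \<open>The lower bound on \<open>k\<close> forces \<open>P\<close> to have dimension at least n
  - 2, which is the most the intersection can have. The intersection can thus be recovered from any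
  such polytope inside it.\<close>

lemma affine_hull_polytope_eq_Int:
  fixes H :: "(real ^ 'n) set"
  assumes n: "3 \<le> CARD('n)" and k: "2 ^ (CARD('n) - 3) < k" and H: "spanned_hyperplane H"
    and g: "g \<in> signed_perms" "act g ` H \<noteq> H"
    and P: "P \<subseteq> H \<inter> act g ` H" "has_num_vertices P k"
  shows "affine hull P = H \<inter> act g ` H"
proof -
  obtain a b where ab: "a \<noteq> 0" "H = {x. a \<bullet> x = b}"
    using H unfolding spanned_hyperplane_def by blast
  have aff: "affine (H \<inter> act g ` H)"
    using H g(1) affine_hull_act unfolding spanned_hyperplane_def
    by (metis affine_Int affine_affine_hull)
  obtain W where W: "W \<subseteq> cube_vertices" "P = convex hull W" "card W = k"
    using P(2) unfolding has_num_vertices_def by blast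
  have "\<not> aff_dim W \<le> int (CARD('n) - 3)"
    using card_cube_vertices_le[OF W(1)] W(3) k by fastforce
  \<comment> \<open>Since n is at least 3, the natural number subtraction n - 3 is exact, and
    exceeding it means reaching n - 2.\<close>
  then have "int CARD('n) - 2 \<le> aff_dim P" using n W(2) by (simp add: aff_dim_convex_hull)
  then have dim: "aff_dim (affine hull P) = aff_dim (H \<inter> act g ` H)"
    using aff_dim_hyperplane_Int_act[OF ab g] aff_dim_subset[OF P(1)] by simp
  have "affine hull P \<noteq> {}"
    using P(2) unfolding has_num_vertices_def by auto
  moreover have "affine hull P \<subseteq> H \<inter> act g ` H" using P(1) aff by (rule hull_minimal)
  ultimately show ?thesis using affine_dim_equal[OF affine_affine_hull aff] dim by blast
qed

section \<open>The map \<open>\<Phi>\<^sub>2\<close>\<close>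

text \<open>The \<open>k\<close> vertices of \<open>P\<close> are themselves the cube vertices that
  membership in \<open>E H k\<close> asks for.\<close>

lemma mem_E:
  assumes "g \<in> signed_perms" "act g ` H \<noteq> H" "P \<subseteq> H \<inter> act g ` H" "has_num_vertices P k"
  shows "H \<inter> act g ` H \<in> E H k"
proof -
  obtain W where W: "W \<subseteq> cube_vertices" "P = convex hull W" "card W = k"
    using assms(4) unfolding has_num_vertices_def by blast
  have "W \<subseteq> H \<inter> act g ` H \<inter> cube_vertices" using W(1,2) assms(3) hull_subset[of W] by blast
  then have "k \<le> card (H \<inter> act g ` H \<inter> cube_vertices)"
    using W(3) card_mono finite_cube_vertices by (metis finite_Int)
  then show ?thesis using assms unfolding E_def by blast
qed

lemma affine_hull_polytope_in_E:
  fixes H :: "(real ^ 'n) set"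
  assumes "3 \<le> CARD('n)" "2 ^ (CARD('n) - 3) < k" "spanned_hyperplane H"
    and "S \<in> E H k" "P \<in> polytopes_in S" "has_num_vertices P k"
  shows "affine hull P = S"
  using affine_hull_polytope_eq_Int[OF assms(1-3)] assms(4-6)
  unfolding E_def polytopes_in_def by blast

lemma Phi2_eq:
  assumes "C \<in> partial_classes (H \<inter> T)" "D \<in> partial_classes H" "C \<subseteq> D"
  shows "Phi2 H (i, C) = D"
  using the1_equality[OF partial_class_unique_extension[OF assms(1), of H]] assms
  unfolding Phi2_def by simp

lemma Phi2_mem:
  assumes "(i, C) \<in> Phi2_domain H k h w"
  shows "Phi2 H (i, C) \<in> partial_classes H" "C \<subseteq> Phi2 H (i, C)"
proof -
  have "C \<in> partial_classes (H \<inter> act (w i) ` H)"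
    using assms unfolding Phi2_domain_def partial_classes_k_def by blast
  from theI'[OF partial_class_unique_extension[OF this, of H]]
  show "Phi2 H (i, C) \<in> partial_classes H" "C \<subseteq> Phi2 H (i, C)"
    unfolding Phi2_def by auto
qed

text \<open>The families \<open>v\<close> and \<open>w\<close> represent the same set
  \<open>E H k\<close> under different groups. An element of the stabilizer moves a polytope of
  \<open>C\<close> into some representative given by \<open>v\<close>, and its local class there
  witnesses the condition of \<open>L_lower\<close>.\<close>

lemma Phi2_mem_P_lower:
  assumes v: "class_reps (stabilizer H) H k h1 v"
    and w: "class_reps signed_perms H k h2 w"
    and iC: "(i, C) \<in> Phi2_domain H k h2 w"
  shows "Phi2 H (i, C) \<in> P_lower H k h1 v"
proof -
  let ?D = "Phi2 H (i, C)" and ?S = "H \<inter> act (w i) ` H"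
  have i: "i \<in> {1..h2}" and C: "C \<in> partial_classes ?S" "\<forall>P\<in>C. has_num_vertices P k"
    using iC unfolding Phi2_domain_def partial_classes_k_def by auto
  obtain P where P: "P \<in> C" "P \<in> polytopes_in ?S" using partial_class_nonempty[OF C(1)] .
  have D: "?D = {Q \<in> polytopes_in H. equivalent_under signed_perms P Q}"
    using partial_class_eq[OF Phi2_mem(1)[OF iC]] Phi2_mem(2)[OF iC] P(1) by blast
  have Dk: "has_num_vertices Q k" if "equivalent_under signed_perms P Q" for Q
    using that C(2) P(1) has_num_vertices_act unfolding equivalent_under_def by blast
  have "?S \<in> E H k" using w i unfolding class_reps_def by blast
  then obtain j g where j: "j \<in> {1..h1}" and g: "g \<in> stabilizer H"
      "act g ` ?S = H \<inter> act (v j) ` H"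
    using v unfolding class_reps_def equivalent_under_def by meson
  let ?T = "H \<inter> act (v j) ` H"
  let ?B = "{Q \<in> polytopes_in ?T. equivalent_under (stabilizer H) (act g ` P) Q}"
  have gP: "act g ` P \<in> polytopes_in ?T"
    using polytopes_in_act[OF _ P(2) g(2)] g(1) unfolding stabilizer_def by blast
  have PgP: "equivalent_under signed_perms P (act g ` P)"
    using g(1) unfolding equivalent_under_def stabilizer_def by blast
  have B: "equivalent_under signed_perms P Q" if "Q \<in> ?B" for Q
    using that PgP equivalent_stabilizer equivalent_trans by blast
  have "?B \<subseteq> ?D" using B unfolding D polytopes_in_def by blast
  moreover have "?B \<in> local_classes_k H ?T k"
    using gP B Dk unfolding local_classes_k_def local_classes_def classes_iff by blast
  \<comment> \<open>\<open>?D\<close> may fail to be a local class; if it is one, then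
    \<open>?B\<close> puts it into \<open>L_lower\<close>. Either way it lies outside
    \<open>L_upper\<close>.\<close>
  ultimately have "?D \<notin> L_upper H k h1 v"
    using j unfolding L_upper_def L_lower_def by blast
  moreover have "?D \<in> partial_classes_k H k"
    using Phi2_mem(1)[OF iC] Dk D unfolding partial_classes_k_def by blast
  ultimately show ?thesis unfolding P_lower_def by blast
qed

lemma P_lower_subset_E:
  assumes v: "class_reps (stabilizer H) H k h1 v" and D: "D \<in> P_lower H k h1 v"
  obtains S P where "S \<in> E H k" "P \<in> D" "P \<in> polytopes_in S"
proof -
  have Dp: "D \<in> partial_classes H" and Dk: "\<forall>P\<in>D. has_num_vertices P k"
    and Dn: "D \<notin> L_upper H k h1 v"
    using D unfolding P_lower_def partial_classes_k_def by auto
  show thesis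
  proof (cases "D \<in> local_classes H H")
    case True
    then have "D \<in> L_lower H k h1 v"
      using Dn Dk unfolding L_upper_def local_classes_k_def by blast
    then obtain j B where j: "j \<in> {1..h1}" and B: "B \<in> local_classes_k H (H \<inter> act (v j) ` H) k"
      "B \<subseteq> D"
      unfolding L_lower_def by blast
    obtain P where "P \<in> B" "P \<in> polytopes_in (H \<inter> act (v j) ` H)"
      using B(1) equivalent_stabilizer_refl
      unfolding local_classes_k_def local_classes_def classes_iff by blast
    moreover have "H \<inter> act (v j) ` H \<in> E H k" using v j unfolding class_reps_def by blast
    ultimately show thesis using that B(2) by blast
  next
    case False
    obtain P where P: "P \<in> D" "P \<in> polytopes_in H" using partial_class_nonempty[OF Dp] .
    note Deq = partial_class_eq[OF Dp P(1)]
    \<comment> \<open>The local class of \<open>P\<close> is then a proper part of \<open>D\<close>,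
      so some \<open>Q\<close> in \<open>D\<close> can be reached from \<open>P\<close> only by
      elements outside the stabilizer.\<close>
    have "D \<noteq> {Q \<in> polytopes_in H. equivalent_under (stabilizer H) P Q}"
      using False P(2) unfolding local_classes_def classes_iff by blast
    moreover have "{Q \<in> polytopes_in H. equivalent_under (stabilizer H) P Q} \<subseteq> D"
      using Deq equivalent_stabilizer by blast
    ultimately obtain Q where Q: "Q \<in> D" "Q \<in> polytopes_in H"
      "\<not> equivalent_under (stabilizer H) P Q" using Deq by blast
    then obtain g where g: "g \<in> signed_perms" "act g ` P = Q"
      using Deq unfolding equivalent_under_def by blast
    then have gH: "act g ` H \<noteq> H"
      using Q(3) unfolding equivalent_under_def stabilizer_def by blast
    \<comment> \<open>\<open>Q\<close> is the image of \<open>P\<close>, and \<open>P\<close> lies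
      in \<open>H\<close>, so \<open>Q\<close> lies in the image of \<open>H\<close> as well as in
      \<open>H\<close>.\<close>
    have QS: "Q \<in> polytopes_in (H \<inter> act g ` H)"
      using P(2) Q(2) g(2) unfolding polytopes_in_def by blast
    then have "H \<inter> act g ` H \<in> E H k"
      using mem_E[OF g(1) gH] Dk Q(1) unfolding polytopes_in_def by blast
    then show thesis using that Q(1) QS by blast
  qed
qed

text \<open>A member of \<open>D\<close> inside some element of \<open>E H k\<close> is carried to
  the representative of that element. The partial class of its image there consists of polytopes
  equivalent to it, so it extends to \<open>D\<close>.\<close>

lemma Phi2_surj:
  assumes v: "class_reps (stabilizer H) H k h1 v"
    and w: "class_reps signed_perms H k h2 w"
    and D: "D \<in> P_lower H k h1 v"
  shows "D \<in> Phi2 H ` Phi2_domain H k h2 w"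
proof -
  have Dp: "D \<in> partial_classes H" and Dk: "\<forall>P\<in>D. has_num_vertices P k"
    using D unfolding P_lower_def partial_classes_k_def by auto
  obtain S P where S: "S \<in> E H k" and P: "P \<in> D" "P \<in> polytopes_in S"
    using P_lower_subset_E[OF v D] .
  obtain i g where i: "i \<in> {1..h2}" and g: "g \<in> signed_perms"
      "act g ` S = H \<inter> act (w i) ` H"
    using w S unfolding class_reps_def equivalent_under_def by meson
  let ?S = "H \<inter> act (w i) ` H"
  let ?C = "{Q \<in> polytopes_in ?S. equivalent_under signed_perms (act g ` P) Q}"
  have gP: "act g ` P \<in> polytopes_in ?S" using polytopes_in_act[OF g(1) P(2) g(2)] .
  have "equivalent_under signed_perms P (act g ` P)"
    using g(1) unfolding equivalent_under_def by blast
  then have "?C \<subseteq> D"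
    using partial_class_eq[OF Dp P(1)] equivalent_trans unfolding polytopes_in_def by blast
  moreover have "?C \<in> partial_classes ?S" using partial_classI[OF gP] .
  ultimately have "(i, ?C) \<in> Phi2_domain H k h2 w" "Phi2 H (i, ?C) = D"
    using i Dk Phi2_eq[OF _ Dp] unfolding Phi2_domain_def partial_classes_k_def by auto
  then show ?thesis using imageI[of "(i, ?C)" _ "Phi2 H"] by (simp only:)
qed

lemma Phi2_inj:
  fixes H :: "(real ^ 'n) set"
  assumes n: "3 \<le> CARD('n)" and k: "2 ^ (CARD('n) - 3) < k" and H: "spanned_hyperplane H"
    and w: "class_reps signed_perms H k h2 w"
    and iC: "(i, C) \<in> Phi2_domain H k h2 w" and jB: "(j, B) \<in> Phi2_domain H k h2 w"
    and eq: "Phi2 H (i, C) = Phi2 H (j, B)"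
  shows "i = j \<and> C = B"
proof -
  have i: "i \<in> {1..h2}" and C: "C \<in> partial_classes (H \<inter> act (w i) ` H)"
      "\<forall>P\<in>C. has_num_vertices P k"
    and j: "j \<in> {1..h2}" and B: "B \<in> partial_classes (H \<inter> act (w j) ` H)"
      "\<forall>P\<in>B. has_num_vertices P k"
    using iC jB unfolding Phi2_domain_def partial_classes_k_def by auto
  obtain P where P: "P \<in> C" "P \<in> polytopes_in (H \<inter> act (w i) ` H)"
    using partial_class_nonempty[OF C(1)] .
  obtain Q where Q: "Q \<in> B" "Q \<in> polytopes_in (H \<inter> act (w j) ` H)"
    using partial_class_nonempty[OF B(1)] .
  have Si: "H \<inter> act (w i) ` H \<in> E H k" and Sj: "H \<inter> act (w j) ` H \<in> E H k"
    using w i j unfolding class_reps_def by auto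
  have "P \<in> Phi2 H (i, C)" "Q \<in> Phi2 H (i, C)"
    using Phi2_mem(2)[OF iC] Phi2_mem(2)[OF jB] P(1) Q(1) eq by auto
  then have PQ: "equivalent_under signed_perms P Q"
    using partial_class_eq[OF Phi2_mem(1)[OF iC]] by blast
  then obtain g where g: "g \<in> signed_perms" "act g ` P = Q"
    unfolding equivalent_under_def by blast
  have "affine hull P = H \<inter> act (w i) ` H" "affine hull Q = H \<inter> act (w j) ` H"
    using affine_hull_polytope_in_E[OF n k H] Si Sj P Q C(2) B(2) by blast+
  \<comment> \<open>\<open>g\<close> was chosen only to map \<open>P\<close> onto \<open>Q\<close>;
    as affine maps commute with affine hulls, it also maps the spanned intersections onto each
    other.\<close>
  then have "act g ` (H \<inter> act (w i) ` H) = H \<inter> act (w j) ` H"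
    using affine_hull_act[OF g(1), of P] g(2) by simp
  then have "equivalent_under signed_perms (H \<inter> act (w i) ` H) (H \<inter> act (w j) ` H)"
    using g(1) unfolding equivalent_under_def by blast
  \<comment> \<open>Intersection \<open>i\<close> is equivalent both to itself and to intersection
    \<open>j\<close>, while only one index may represent it.\<close>
  then have ij: "i = j"
    using w i j Si equivalent_refl unfolding class_reps_def by blast
  \<comment> \<open>Now \<open>C\<close> and \<open>B\<close> are partial classes of the same set,
    so sharing \<open>Q\<close> makes them equal.\<close>
  have "Q \<in> C" using partial_class_eq[OF C(1) P(1)] Q(2) PQ ij by blast
  then have "C = B"
    using partial_class_eq[OF C(1)] partial_class_eq[OF B(1) Q(1)] ij by blast
  with ij show ?thesis by blast
qed

theorem theorem8p2:
  fixes H :: "(real ^ 'n) set" and k h1 h2 :: nat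
    and v w :: "nat \<Rightarrow> 'n signed_perm"
  assumes "3 \<le> CARD('n)"
    and "2 ^ (CARD('n) - 3) < k" and "k \<le> 2 ^ (CARD('n) - 2)"
    and "spanned_hyperplane H"
    and "k \<le> card (H \<inter> cube_vertices)"
    and "class_reps (stabilizer H) H k h1 v"
    and "class_reps signed_perms H k h2 w"
  shows "(\<forall>(i, C) \<in> Phi2_domain H k h2 w. \<exists>!D. D \<in> partial_classes H \<and> C \<subseteq> D) \<and>
    Phi2 H ` Phi2_domain H k h2 w \<subseteq> P_lower H k h1 v \<and>
    bij_betw (Phi2 H) (Phi2_domain H k h2 w) (P_lower H k h1 v)"
proof (intro conjI)
  have "\<exists>!D. D \<in> partial_classes H \<and> C \<subseteq> D" if "(i, C) \<in> Phi2_domain H k h2 w" for i C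
    using that partial_class_unique_extension[of C "H \<inter> act (w i) ` H" H]
    unfolding Phi2_domain_def partial_classes_k_def by blast
  then show "\<forall>(i, C) \<in> Phi2_domain H k h2 w. \<exists>!D. D \<in> partial_classes H \<and> C \<subseteq> D"
    by blast
  show sub: "Phi2 H ` Phi2_domain H k h2 w \<subseteq> P_lower H k h1 v"
    using Phi2_mem_P_lower[OF assms(6,7)] by auto
  have "inj_on (Phi2 H) (Phi2_domain H k h2 w)"
    using Phi2_inj[OF assms(1,2,4,7)] unfolding inj_on_def by auto
  then show "bij_betw (Phi2 H) (Phi2_domain H k h2 w) (P_lower H k h1 v)"
    using sub Phi2_surj[OF assms(6,7)] unfolding bij_betw_def by blast
qed

end
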